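(* (i) $E_1(x)=-\tfrac12(1-2x-x^2)+\tfrac{1-3x}{4}(1-4x)^{-1/2}+\tfrac{1-3x-4x^2+4x^3}{4}(1-4x^2)^{-1/2}$. (ii) $O_1(x)=-\tfrac12(x+x^2)+\tfrac{1-3x}{4}(1-4x)^{-1/2}-\tfrac{1-3x-4x^2+4x^3}{4}(1-4x^2)^{-1/2}$. (iii) $F_1(x)=\tfrac12(x-1)+\tfrac{1-3x}{2}(1-4x)^{-1/2}$.
   Context: An occurrence of $132$ in $\pi=\pi_1\cdots\pi_n\in\mathfrak S_n$ is a triple $i<j<k$ with $\pi_i<\pi_k<\pi_j$. A permutation is even or odd according to the parity of its number of inversions. $E_1(x)$ is $\sum_{n\ge0}$ (number of even $\pi\in\mathfrak S_n$ with exactly one occurrence of $132$) $x^n$. $O_1(x)$ is the same with odd permutations. $F_1(x)=E_1(x)+O_1(x)$ is the generating function of all permutations with exactly one occurrence of $132$. *)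

theory Defs
  imports "HOL-Computational_Algebra.Formal_Power_Series" "HOL-Combinatorics.Permutations"
begin

text \<open>Permutations in \<open>S\<^sub>n\<close> are functions \<open>p\<close> with \<open>p permutes {1..n}\<close>, read as the words
  \<open>p 1, ..., p n\<close>.\<close>

definition inversions :: "nat \<Rightarrow> (nat \<Rightarrow> nat) \<Rightarrow> (nat \<times> nat) set" where
  "inversions n p = {(i, j). i \<in> {1..n} \<and> j \<in> {1..n} \<and> i < j \<and> p j < p i}"

definition occs132 :: "nat \<Rightarrow> (nat \<Rightarrow> nat) \<Rightarrow> (nat \<times> nat \<times> nat) set" where
  "occs132 n p = {(i, j, k). i \<in> {1..n} \<and> j \<in> {1..n} \<and> k \<in> {1..n} \<and>
     i < j \<and> j < k \<and> p i < p k \<and> p k < p j}"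

definition one132 :: "nat \<Rightarrow> (nat \<Rightarrow> nat) set" where
  "one132 n = {p. p permutes {1..n} \<and> card (occs132 n p) = 1}"

definition E1 :: "real fps" where
  "E1 = Abs_fps (\<lambda>n. of_nat (card {p \<in> one132 n. even (card (inversions n p))}))"

definition O1 :: "real fps" where
  "O1 = Abs_fps (\<lambda>n. of_nat (card {p \<in> one132 n. odd (card (inversions n p))}))"

definition F1 :: "real fps" where
  "F1 = E1 + O1"

lemma finite_one132: "finite (one132 n)"
  by (rule finite_subset[OF _ finite_permutations[of "{1..n}"]]) (auto simp: one132_def)

lemma F1_nth: "fps_nth F1 n = of_nat (card (one132 n))"
proof -
  have "one132 n = {p \<in> one132 n. even (card (inversions n p))} \<union>
                   {p \<in> one132 n. odd (card (inversions n p))}"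
    by auto
  moreover have "card ({p \<in> one132 n. even (card (inversions n p))} \<union>
                       {p \<in> one132 n. odd (card (inversions n p))}) =
      card {p \<in> one132 n. even (card (inversions n p))} +
      card {p \<in> one132 n. odd (card (inversions n p))}"
    by (rule card_Un_disjoint) (auto simp: finite_one132)
  ultimately show ?thesis
    by (simp add: F1_def E1_def O1_def)
qed

text \<open>\<open>(1 + u)\<^sup>-\<^sup>1\<^sup>/\<^sup>2\<close> as a formal power series; \<open>fps_binomial c\<close> is \<open>(1 + X)\<^sup>c\<close>.
  Only meaningful if \<open>u\<close> has zero constant term.\<close>

definition inv_sqrt_one_plus :: "real fps \<Rightarrow> real fps" where
  "inv_sqrt_one_plus u = fps_binomial (- 1 / 2) oo u"

lemma inv_sqrt_one_plus_square:
  assumes "fps_nth u 0 = 0"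
  shows "inv_sqrt_one_plus u ^ 2 * (1 + u) = 1"
proof -
  have "inv_sqrt_one_plus u ^ 2 = (fps_binomial (- 1 / 2) * fps_binomial (- 1 / 2)) oo u"
    using assms by (simp add: inv_sqrt_one_plus_def power2_eq_square fps_compose_mult_distrib)
  also have "fps_binomial (- 1 / 2) * fps_binomial (- 1 / 2) = fps_binomial (- 1 :: real)"
    by (simp flip: fps_binomial_add_mult)
  finally have *: "inv_sqrt_one_plus u ^ 2 = fps_binomial (- 1) oo u" .
  have "fps_binomial (- 1) * (1 + fps_X) = (fps_binomial (- 1) * fps_binomial 1 :: real fps)"
    by (simp add: fps_binomial_1)
  also have "\<dots> = 1"
    by (simp flip: fps_binomial_add_mult)
  finally have "(fps_binomial (- 1) oo u) * ((1 + fps_X) oo u) = 1 oo u"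
    using assms by (simp flip: fps_compose_mult_distrib)
  then show ?thesis
    using assms by (simp add: * fps_compose_add_distrib)
qed

end

theory Submission
  imports Defs "HOL-Library.Infinite_Set"
begin

text \<open>Cut a word on \<open>{0..n}\<close> at its maximum, as \<open>xs @ n # ys\<close>. A pair \<open>x < y\<close> with \<open>x\<close> left
  and \<open>y\<close> right of the maximum is the outer part of an occurrence \<open>x n y\<close> of 132. If there is no
  such pair, then \<open>xs\<close> consists of the large and \<open>ys\<close> of the small letters, and no occurrence
  meets both parts. If the only occurrence is \<open>a n b\<close>, then \<open>a\<close> must end the left part (a later
  letter \<open>c\<close> there would give \<open>a c b\<close>) and \<open>a\<close>, \<open>b\<close> are consecutive values that trade sides.
  Weighting words by \<open>q\<close> to the number of inversions turns this into convolution recurrences for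
  the avoiders \<open>C\<close> and the one-occurrence words \<open>F\<close>.

  At \<open>q = 1\<close> they read \<open>C = 1 + x C\<^sup>2\<close> and \<open>F = 2 x F C + x\<^sup>2 C (C - 1)\<close>. At \<open>q = -1\<close> the signs
  depend only on the parities of the two lengths and are absorbed by \<open>x \<mapsto> -x\<close>; it turns out that
  \<open>C = 1 + Q\<close> with \<open>Q = x (1 + Q\<^sup>2)\<close> odd, and \<open>F\<close> solves a linear equation. In the two cases the
  inverse square root in the answer is the inverse of \<open>1 - 2 x C\<close> and of \<open>1 - 2 x Q\<close>.\<close>

unbundle fps_syntax

section \<open>Inversions and occurrences of 132 in words\<close>

primrec inversion_count :: "'a::linorder list \<Rightarrow> nat" where
  "inversion_count [] = 0"
| "inversion_count (x # xs) = length (filter (\<lambda>y. y < x) xs) + inversion_count xs"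

text \<open>With \<open>x\<close> in the role of 1, the other two letters of an occurrence are an
  inversion among the later letters above \<open>x\<close>.\<close>

primrec occ132_count :: "'a::linorder list \<Rightarrow> nat" where
  "occ132_count [] = 0"
| "occ132_count (x # xs) = inversion_count (filter (\<lambda>y. x < y) xs) + occ132_count xs"

lemma inversion_count_map:
  assumes "strict_mono_on (set xs) f"
  shows "inversion_count (map f xs) = inversion_count xs"
  using assms
proof (induction xs)
  case (Cons x xs)
  have "filter (\<lambda>y. f y < f x) xs = filter (\<lambda>y. y < x) xs"
    using Cons.prems by (intro filter_cong) (auto simp: strict_mono_on_less)
  with Cons show ?case
    by (auto simp: filter_map o_def intro: monotone_on_subset)
qed simp

lemma occ132_count_map:
  assumes "strict_mono_on (set xs) f"
  shows "occ132_count (map f xs) = occ132_count xs"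
  using assms
proof (induction xs)
  case (Cons x xs)
  have "filter (\<lambda>y. f x < f y) xs = filter (\<lambda>y. x < y) xs"
    using Cons.prems by (intro filter_cong) (auto simp: strict_mono_on_less)
  moreover have "inversion_count (map f (filter (\<lambda>y. x < y) xs)) = inversion_count (filter (\<lambda>y. x < y) xs)"
    by (rule inversion_count_map) (use Cons.prems in \<open>auto intro: monotone_on_subset\<close>)
  ultimately show ?case
    using Cons by (auto simp: filter_map o_def intro: monotone_on_subset)
qed simp

lemma card_split:
  assumes "A = B \<union> C" "B \<inter> C = {}" "finite A"
  shows "card A = card B + card C"
  using assms by (metis card_Un_disjoint finite_Un)

text \<open>The filter is carried along because \<open>occ132_count\<close> takes inversions of
  filtered tails. The induction removes the first position.\<close>

lemma inversion_count_filter_map_upt: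
  "inversion_count (filter P (map p [a..<b])) =
   card {(i, j). a \<le> i \<and> i < j \<and> j < b \<and> P (p i) \<and> P (p j) \<and> p j < p i}"
proof (induction "b - a" arbitrary: a)
  case 0
  then show ?case by (simp add: card_eq_0_iff)
next
  case (Suc d)
  let ?S = "\<lambda>a. {(i, j). a \<le> i \<and> i < j \<and> j < b \<and> P (p i) \<and> P (p j) \<and> p j < p i}"
  have ab: "a < b" and d: "d = b - Suc a" using Suc.hyps(2) by auto
  have fin: "finite (?S a)" by (rule finite_subset[of _ "{..<b} \<times> {..<b}"]) auto
  \<comment> \<open>These are the inversions whose first position is \<open>a\<close>; all others
    already belong to the range from \<open>Suc a\<close> on.\<close>
  let ?H = "Pair a ` {j. Suc a \<le> j \<and> j < b \<and> P (p a) \<and> P (p j) \<and> p j < p a}"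
  have "card (?S a) = card ?H + card (?S (Suc a))"
    by (rule card_split) (use ab fin in \<open>auto simp: not_less_eq_eq le_eq_less_or_eq\<close>)
  also have "card ?H = card {j. Suc a \<le> j \<and> j < b \<and> P (p a) \<and> P (p j) \<and> p j < p a}"
    by (rule card_image) (auto intro: inj_onI)
  also have "\<dots> = (if P (p a) then length (filter (\<lambda>y. y < p a) (filter P (map p [Suc a..<b]))) else 0)"
    by (auto simp: filter_map o_def simp flip: distinct_card intro!: arg_cong[of _ _ card])
  finally show ?case
    using Suc.hyps(1)[OF d] ab by (simp add: upt_conv_Cons)
qed

lemma inversion_count_map_upt:
  "inversion_count (map p [a..<b]) = card {(i, j). a \<le> i \<and> i < j \<and> j < b \<and> p j < p i}"
  using inversion_count_filter_map_upt[of "\<lambda>_. True"] by simp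

lemma occ132_count_map_upt:
  "occ132_count (map p [a..<b]) =
   card {(i, j, k). a \<le> i \<and> i < j \<and> j < k \<and> k < b \<and> p i < p k \<and> p k < p j}"
proof (induction "b - a" arbitrary: a)
  case 0
  then show ?case by (simp add: card_eq_0_iff)
next
  case (Suc d)
  let ?S = "\<lambda>a. {(i, j, k). a \<le> i \<and> i < j \<and> j < k \<and> k < b \<and> p i < p k \<and> p k < p j}"
  have ab: "a < b" and d: "d = b - Suc a" using Suc.hyps(2) by auto
  have fin: "finite (?S a)" by (rule finite_subset[of _ "{..<b} \<times> {..<b} \<times> {..<b}"]) auto
  let ?H = "{(j, k). Suc a \<le> j \<and> j < k \<and> k < b \<and> p a < p j \<and> p a < p k \<and> p k < p j}"
  have "card (?S a) = card (Pair a ` ?H) + card (?S (Suc a))"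
    by (rule card_split) (use ab fin in \<open>auto simp: not_less_eq_eq le_eq_less_or_eq\<close>)
  also have "card (Pair a ` ?H) = card ?H"
    by (rule card_image) (auto intro: inj_onI)
  finally show ?case
    using Suc.hyps(1)[OF d] ab by (simp add: upt_conv_Cons inversion_count_filter_map_upt)
qed

section \<open>Words over a finite alphabet and their inversion enumerator\<close>

definition words :: "nat \<Rightarrow> nat set \<Rightarrow> nat list set" where
  "words k V = {xs. distinct xs \<and> set xs = V \<and> occ132_count xs = k}"

lemma finite_words [simp]: "finite V \<Longrightarrow> finite (words k V)"
  by (rule finite_subset[OF _ finite_lists_length_le[of V "card V"]])
    (auto simp: words_def distinct_card)

lemma length_words: "xs \<in> words k V \<Longrightarrow> length xs = card V"
  using distinct_card[of xs] by (simp add: words_def)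

lemma one132_bij_betw_words:
  "bij_betw (\<lambda>p. map p [1..<Suc n]) (one132 n) (words 1 {1..n})"
proof (rule bij_betw_imageI)
  show "inj_on (\<lambda>p. map p [1..<Suc n]) (one132 n)"
  proof (rule inj_onI)
    fix p q assume pq: "p \<in> one132 n" "q \<in> one132 n" "map p [1..<Suc n] = map q [1..<Suc n]"
    show "p = q"
    proof
      fix i
      show "p i = q i"
      proof (cases "i \<in> {1..n}")
        case True
        then have "i \<in> set [1..<Suc n]" unfolding set_upt by simp
        then show ?thesis using pq(3) unfolding map_eq_conv by blast
      next
        case False
        then show ?thesis using pq by (auto simp: one132_def permutes_def)
      qed
    qed
  qed
next
  have occ: "occ132_count (map p [1..<Suc n]) = card (occs132 n p)" for p
    unfolding occ132_count_map_upt occs132_def by (rule arg_cong[of _ _ card]) auto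
  have iv: "set [1..<Suc n] = {1..n}" by (simp only: set_upt atLeastLessThanSuc_atLeastAtMost)
  show "(\<lambda>p. map p [1..<Suc n]) ` one132 n = words 1 {1..n}"
  proof (intro equalityI subsetI)
    fix xs assume "xs \<in> (\<lambda>p. map p [1..<Suc n]) ` one132 n"
    then obtain p where p: "p permutes {1..n}" "card (occs132 n p) = 1" and xs: "xs = map p [1..<Suc n]"
      by (auto simp: one132_def)
    show "xs \<in> words 1 {1..n}"
      unfolding words_def mem_Collect_eq xs occ
      using p permutes_inj_on[OF p(1)] permutes_image[OF p(1)]
      by (simp only: distinct_map set_map iv distinct_upt simp_thms)
  next
    fix xs assume "xs \<in> words 1 {1..n}"
    then have xs: "distinct xs" "set xs = {1..n}" "occ132_count xs = 1"
      by (auto simp: words_def)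
    then have len: "length xs = n" using distinct_card by fastforce
    \<comment> \<open>List entries are indexed from 0 and permutation values from 1; outside
      \<open>{1..n}\<close> the predicate \<open>permutes\<close> demands fixed points.\<close>
    define p where "p = (\<lambda>i. if i \<in> {1..n} then xs ! (i - 1) else i)"
    have map: "map p [1..<Suc n] = xs"
      by (rule nth_equalityI) (simp_all add: len p_def del: upt_Suc)
    have "p ` {1..n} = {1..n}"
      using xs(2) by (subst iv[symmetric], subst set_map[symmetric], subst map) simp
    moreover have "inj_on p {1..n}"
      using xs(1) unfolding map[symmetric] distinct_map iv by simp
    ultimately have "p permutes {1..n}"
      by (intro bij_imp_permutes) (auto simp: bij_betw_def p_def)
    with xs(3) have "p \<in> one132 n"
      unfolding one132_def map[symmetric] occ by simp
    then show "xs \<in> (\<lambda>p. map p [1..<Suc n]) ` one132 n"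
      using map by blast
  qed
qed

text \<open>At \<open>q = 1\<close> this counts the words; at \<open>q = -1\<close> it is the number
  of even words minus the number of odd ones.\<close>

definition inv_poly :: "'a::comm_ring_1 \<Rightarrow> nat \<Rightarrow> nat set \<Rightarrow> 'a" where
  "inv_poly q k V = (\<Sum>xs\<in>words k V. q ^ inversion_count xs)"

text \<open>The increasing relabelling of \<open>{..<n}\<close> by \<open>V\<close> preserves
  inversions and occurrences. It standardises the parts into which a maximum cuts a word.\<close>

lemma inv_poly_card:
  assumes "finite V"
  shows "inv_poly q k V = inv_poly q k {..<card V}"
proof -
  define n where "n = card V"
  obtain h where "bij_betw h {..<n} V" and mono: "strict_mono_on {..<n} h"
    using ex_bij_betw_strict_mono_card[OF assms] unfolding n_def .
  then have inj: "inj_on h {..<n}" and im: "h ` {..<n} = V"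
    by (simp_all add: bij_betw_def)
  have "bij_betw (map h) (words k {..<n}) (words k V)"
  proof (rule bij_betw_imageI)
    show "inj_on (map h) (words k {..<n})"
      using inj by (auto simp: words_def inj_on_def[of "map h"] intro: map_inj_on)
    show "map h ` words k {..<n} = words k V"
    proof (intro equalityI subsetI)
      fix ys assume "ys \<in> map h ` words k {..<n}"
      then obtain xs where xs: "distinct xs" "set xs = {..<n}" "occ132_count xs = k" "ys = map h xs"
        by (auto simp: words_def)
      then show "ys \<in> words k V"
        using inj im mono by (simp add: words_def occ132_count_map distinct_map)
    next
      fix ys assume "ys \<in> words k V"
      then have ys: "distinct ys" "set ys = V" "occ132_count ys = k"
        by (auto simp: words_def)
      have "ys \<in> lists (h ` {..<n})"
        using ys(2) by (simp add: im in_lists_conv_set)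
      then obtain xs where xs: "set xs \<subseteq> {..<n}" "ys = map h xs"
        unfolding lists_image by auto
      have "h ` set xs = h ` {..<n}"
        using ys(2) im xs(2) by simp
      then have set: "set xs = {..<n}"
        using inj_on_image_eq_iff[OF inj xs(1) order_refl] by simp
      then have "xs \<in> words k {..<n}"
        using ys(1,3) mono xs(2) by (simp add: words_def occ132_count_map distinct_map)
      then show "ys \<in> map h ` words k {..<n}" using xs(2) by blast
    qed
  qed
  then have "inv_poly q k V = (\<Sum>xs\<in>words k {..<n}. q ^ inversion_count (map h xs))"
    unfolding inv_poly_def by (rule sum.reindex_bij_betw[symmetric])
  also have "\<dots> = inv_poly q k {..<n}"
    unfolding inv_poly_def using mono
    by (intro sum.cong) (auto simp: words_def inversion_count_map)
  finally show ?thesis by (simp only: n_def)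
qed

lemma inv_poly_one132:
  "inv_poly q 1 {..<n} = (\<Sum>p\<in>one132 n. q ^ card (inversions n p))"
proof -
  have "inv_poly q 1 {..<n} = inv_poly q 1 {1..n}"
    by (subst inv_poly_card[of "{1..n}"]) simp_all
  also have "\<dots> = (\<Sum>p\<in>one132 n. q ^ inversion_count (map p [1..<Suc n]))"
    unfolding inv_poly_def
    by (rule sum.reindex_bij_betw[OF one132_bij_betw_words, symmetric])
  also have "\<dots> = (\<Sum>p\<in>one132 n. q ^ card (inversions n p))"
  proof -
    have "inversion_count (map p [1..<Suc n]) = card (inversions n p)" for p
      unfolding inversion_count_map_upt inversions_def by (rule arg_cong[of _ _ card]) auto
    then show ?thesis by simp
  qed
  finally show ?thesis .
qed

section \<open>Both counts for a word cut at its maximum\<close>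

lemma inversion_count_append:
  "inversion_count (xs @ ys) =
   inversion_count xs + inversion_count ys + (\<Sum>x\<leftarrow>xs. length (filter (\<lambda>y. y < x) ys))"
  by (induction xs) auto

lemma inversion_count_append_gt:
  assumes "\<And>x y. x \<in> set xs \<Longrightarrow> y \<in> set ys \<Longrightarrow> y < x"
  shows "inversion_count (xs @ ys) = inversion_count xs + inversion_count ys + length xs * length ys"
proof -
  have "(\<Sum>x\<leftarrow>xs. length (filter (\<lambda>y. y < x) ys)) = (\<Sum>x\<leftarrow>xs. length ys)"
    using assms by (intro arg_cong[of _ _ sum_list] map_cong) (auto cong: filter_cong)
  then show ?thesis
    by (simp add: inversion_count_append sum_list_triv)
qed

lemma inversion_count_Cons_max:
  assumes "\<And>y. y \<in> set ys \<Longrightarrow> y < m"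
  shows "inversion_count (m # ys) = length ys + inversion_count ys"
  using assms by (auto cong: filter_cong)

lemma inversion_count_insert_max:
  assumes "\<And>x. x \<in> set xs \<Longrightarrow> x < m" "\<And>y. y \<in> set ys \<Longrightarrow> y < m"
  shows "inversion_count (xs @ m # ys) = inversion_count (xs @ ys) + length ys"
proof -
  have "(\<Sum>x\<leftarrow>xs. length (filter (\<lambda>y. y < x) (m # ys))) = (\<Sum>x\<leftarrow>xs. length (filter (\<lambda>y. y < x) ys))"
    using assms(1) by (intro arg_cong[of _ _ sum_list] map_cong) fastforce+
  then show ?thesis
    using inversion_count_Cons_max[of ys m] assms(2) by (simp add: inversion_count_append)
qed

lemma occ132_count_Cons_max:
  assumes "\<And>y. y \<in> set ys \<Longrightarrow> y < m"
  shows "occ132_count (m # ys) = occ132_count ys"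
proof -
  have "filter (\<lambda>y. m < y) ys = []"
    using assms by (auto simp: filter_empty_conv dest: less_asym)
  then show ?thesis by simp
qed

text \<open>Among the letters above \<open>x\<close> the maximum \<open>m\<close> is still the
  largest, so it adds one inversion for each such letter of \<open>ys\<close>. These are the
  occurrences \<open>x m y\<close>.\<close>

lemma occ132_count_Cons_insert_max:
  assumes "x < m" "\<And>x. x \<in> set xs \<Longrightarrow> x < m" "\<And>y. y \<in> set ys \<Longrightarrow> y < m"
  shows "occ132_count (x # xs @ m # ys) =
    inversion_count (filter (\<lambda>z. x < z) (xs @ ys)) + length (filter (\<lambda>z. x < z) ys) + occ132_count (xs @ m # ys)"
  using assms inversion_count_insert_max[of "filter (\<lambda>z. x < z) xs" m "filter (\<lambda>z. x < z) ys"]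
  by simp

text \<open>The maximum can only be the middle letter of an occurrence, and an occurrence that
  begins in \<open>xs\<close> and ends in \<open>ys\<close> would need its first letter below its
  last.\<close>

lemma occ132_count_insert_max_gt:
  assumes "\<And>x. x \<in> set xs \<Longrightarrow> x < m" "\<And>y. y \<in> set ys \<Longrightarrow> y < m"
    and "\<And>x y. x \<in> set xs \<Longrightarrow> y \<in> set ys \<Longrightarrow> y < x"
  shows "occ132_count (xs @ m # ys) = occ132_count xs + occ132_count ys"
  using assms
proof (induction xs)
  case Nil
  then show ?case using occ132_count_Cons_max[of ys m] by simp
next
  case (Cons x xs)
  have "filter (\<lambda>z. x < z) ys = []"
    using Cons.prems(3) by (auto simp: filter_empty_conv dest: less_asym)
  then show ?case
    using Cons occ132_count_Cons_insert_max[of x m xs ys] by simp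
qed

text \<open>The sum counts the occurrences \<open>x m y\<close>. Those that meet both parts but
  avoid \<open>m\<close> are dropped, hence only a bound.\<close>

lemma occ132_count_insert_max_ge:
  assumes "\<And>x. x \<in> set xs \<Longrightarrow> x < m" "\<And>y. y \<in> set ys \<Longrightarrow> y < m"
  shows "occ132_count xs + occ132_count ys + (\<Sum>x\<leftarrow>xs. length (filter (\<lambda>y. x < y) ys))
    \<le> occ132_count (xs @ m # ys)"
  using assms
proof (induction xs)
  case Nil
  then show ?case using occ132_count_Cons_max[of ys m] by simp
next
  case (Cons x xs)
  have "inversion_count (filter (\<lambda>z. x < z) xs) \<le> inversion_count (filter (\<lambda>z. x < z) (xs @ ys))"
    by (simp add: inversion_count_append)
  then show ?case
    using Cons occ132_count_Cons_insert_max[of x m xs ys] by simp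
qed

text \<open>The only new occurrence is \<open>a m b\<close>: after \<open>a\<close> only
  \<open>m\<close> and \<open>b\<close> are larger, and each letter of \<open>xs\<close> exceeds
  \<open>a\<close> and all of \<open>ys\<close>.\<close>

lemma occ132_count_insert_max_swap:
  assumes "\<And>x. x \<in> set xs \<Longrightarrow> x < m" "\<And>y. y \<in> set ys \<Longrightarrow> y < m"
    and "distinct ys" "b \<in> set ys" "a < b"
    and "\<And>x y. x \<in> set xs \<Longrightarrow> y \<in> set ys \<Longrightarrow> y < x"
    and "\<And>y. y \<in> set ys \<Longrightarrow> y \<noteq> b \<Longrightarrow> y < a"
  shows "occ132_count (xs @ a # m # ys) = Suc (occ132_count xs + occ132_count ys)"
  using assms(1,6)
proof (induction xs)
  case Nil
  have *: "a < y \<longleftrightarrow> y = b" if "y \<in> set ys" for y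
    using assms(5) assms(7)[of y] that by (metis less_asym)
  have "filter (\<lambda>y. a < y) ys = [b]"
  proof -
    have "filter (\<lambda>y. a < y) ys = filter (\<lambda>y. y = b) ys"
      by (rule filter_cong) (auto simp: *)
    also have "\<dots> = [b]" using assms(3,4)
      by (induction ys) (auto simp: filter_empty_conv)
    finally show ?thesis .
  qed
  moreover have "a < m" using assms by (meson less_trans)
  ultimately show ?case
    using occ132_count_Cons_max[of ys m] assms(2,4) by simp
next
  case (Cons x xs)
  have "a < m" using assms by (meson less_trans)
  have "b < x" using Cons assms by simp
  then have "\<not> x < a" using assms(5) by simp
  have "filter (\<lambda>z. x < z) ys = []"
    using Cons.prems by (auto simp: filter_empty_conv dest: less_asym)
  \<comment> \<open>Here \<open>a\<close> is counted with the left part, so that \<open>m\<close>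
    again separates the two parts.\<close>
  moreover have "occ132_count (x # (xs @ [a]) @ m # ys) =
    inversion_count (filter (\<lambda>z. x < z) ((xs @ [a]) @ ys)) + length (filter (\<lambda>z. x < z) ys)
    + occ132_count ((xs @ [a]) @ m # ys)"
    by (rule occ132_count_Cons_insert_max) (use Cons.prems assms(2) \<open>a < m\<close> in auto)
  ultimately show ?case
    using Cons \<open>\<not> x < a\<close> by simp
qed

lemma occ132_count_le_append_left: "occ132_count xs \<le> occ132_count (xs @ ys)"
  by (induction xs) (auto simp: inversion_count_append add_le_mono trans_le_add1)

lemma occ132_count_le_append_right: "occ132_count ys \<le> occ132_count (xs @ ys)"
  by (induction xs) auto

section \<open>Decomposition of the words with at most one occurrence\<close>

lemma downclosed_eq_lessThan_card:
  fixes A B :: "nat set"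
  assumes "A \<union> B = {..<n}" "\<And>x y. x \<in> A \<Longrightarrow> y \<in> B \<Longrightarrow> y < x"
  shows "B = {..<card B}" "A = {card B..<n}"
proof -
  have "finite B" using assms(1) by (metis finite_Un finite_lessThan)
  have "\<exists>m. B = {..<m}"
  proof (cases "B = {}")
    case False
    \<comment> \<open>An element of \<open>A\<close> cannot lie below \<open>Max B\<close>, so
      \<open>B\<close> contains everything up to its maximum.\<close>
    define M where "M = Max B"
    have M: "M \<in> B" "\<And>x. x \<in> B \<Longrightarrow> x \<le> M"
      using \<open>finite B\<close> False by (simp_all add: M_def)
    have "x \<in> B" if "x \<le> M" for x
    proof -
      have "M \<in> {..<n}" using M(1) assms(1) by blast
      then have "x \<in> A \<union> B" unfolding assms(1) using that by simp
      then show ?thesis using assms(2)[OF _ M(1)] that by force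
    qed
    then have "B = {..<Suc M}" using M(2) by (auto simp: less_Suc_eq_le)
    then show ?thesis by blast
  qed auto
  then obtain m where m: "B = {..<m}" by blast
  then show "B = {..<card B}" by simp
  have "A \<inter> B = {}" using assms(2) less_irrefl by blast
  then have "A = {..<n} - B" using assms(1) by blast
  also have "\<dots> = {card B..<n}" by (auto simp: m)
  finally show "A = {card B..<n}" .
qed

text \<open>Here \<open>r\<close> is the length of the part after the maximum.\<close>

definition splits :: "nat \<Rightarrow> nat \<Rightarrow> nat \<Rightarrow> nat list set" where
  "splits i j n = (\<lambda>(r, xs, ys). xs @ n # ys) ` (SIGMA r:{..n}. words i {r..<n} \<times> words j {..<r})"

text \<open>The words whose only occurrence of 132 is \<open>s n (Suc s)\<close>.\<close>

definition swapped_splits :: "nat \<Rightarrow> nat list set" where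
  "swapped_splits n = (\<lambda>(s, xs, ys). xs @ s # n # ys) `
     (SIGMA s:{..<n - 1}. words 0 {Suc (Suc s)..<n} \<times> words 0 (insert (Suc s) {..<s}))"

lemma splits_subset_words: "splits i j n \<subseteq> words (i + j) {..<Suc n}"
proof -
  have "xs @ n # ys \<in> words (i + j) {..<Suc n}"
    if "r \<le> n" "xs \<in> words i {r..<n}" "ys \<in> words j {..<r}" for r xs ys
  proof -
    have "occ132_count (xs @ n # ys) = occ132_count xs + occ132_count ys"
      by (rule occ132_count_insert_max_gt) (use that in \<open>auto simp: words_def\<close>)
    then show ?thesis using that by (auto simp: words_def)
  qed
  then show ?thesis by (auto simp: splits_def)
qed

lemma swapped_splits_subset_words: "swapped_splits n \<subseteq> words 1 {..<Suc n}"
proof -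
  have "xs @ s # n # ys \<in> words 1 {..<Suc n}"
    if "s < n - 1" "xs \<in> words 0 {Suc (Suc s)..<n}" "ys \<in> words 0 (insert (Suc s) {..<s})" for s xs ys
  proof -
    have "occ132_count (xs @ s # n # ys) = Suc (occ132_count xs + occ132_count ys)"
      by (rule occ132_count_insert_max_swap[where b = "Suc s"]) (use that in \<open>auto simp: words_def\<close>)
    then show ?thesis using that by (auto simp: words_def)
  qed
  then show ?thesis by (auto simp: swapped_splits_def)
qed

text \<open>The letters of \<open>ys\<close> form an initial segment, so the length of
  \<open>ys\<close> serves as the cut \<open>r\<close>.\<close>

lemma splits_memI:
  assumes "distinct (xs @ n # ys)" "set (xs @ n # ys) = {..<Suc n}"
    and "\<And>x y. x \<in> set xs \<Longrightarrow> y \<in> set ys \<Longrightarrow> y < x"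
  shows "xs @ n # ys \<in> splits (occ132_count xs) (occ132_count ys) n"
proof -
  have "set xs \<union> set ys = {..<n}"
    using assms(1,2) by (auto simp: lessThan_Suc)
  from downclosed_eq_lessThan_card[OF this assms(3)]
  have ys: "set ys = {..<length ys}" and xs: "set xs = {length ys..<n}"
    using assms(1) by (simp_all add: distinct_card)
  have "length ys \<le> n"
    using \<open>set xs \<union> set ys = {..<n}\<close> ys by (metis Un_upper2 lessThan_subset_iff)
  then show ?thesis
    unfolding splits_def using xs ys assms(1)
    by (intro image_eqI[of _ _ "(length ys, xs, ys)"]) (auto simp: words_def)
qed

text \<open>The letter \<open>a\<close> together with \<open>ys\<close> fills an initial segment.
  Since all of \<open>ys\<close> except \<open>b\<close> lies below \<open>a\<close>, the top of the
  segment is \<open>b\<close> and the letter just under it is \<open>a\<close>.\<close>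

lemma swapped_splits_memI:
  assumes "distinct (xs @ a # n # ys)" "set (xs @ a # n # ys) = {..<Suc n}"
    and "b \<in> set ys" "a < b" "\<And>y. y \<in> set ys \<Longrightarrow> y \<noteq> b \<Longrightarrow> y < a"
    and "\<And>x y. x \<in> set xs \<Longrightarrow> y \<in> set ys \<Longrightarrow> y < x"
    and "occ132_count xs = 0" "occ132_count ys = 0"
  shows "xs @ a # n # ys \<in> swapped_splits n"
proof -
  have un: "set xs \<union> insert a (set ys) = {..<n}"
    using assms(1,2) by (auto simp: lessThan_Suc)
  have gt: "y < x" if "x \<in> set xs" "y \<in> insert a (set ys)" for x y
    using that assms(3,4,6) by (metis insert_iff less_trans)
  from downclosed_eq_lessThan_card[OF un gt]
  have ay: "insert a (set ys) = {..<Suc (length ys)}" and xs: "set xs = {Suc (length ys)..<n}"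
    using assms(1) by (simp_all add: distinct_card)
  have b: "b = length ys"
  proof -
    have l: "length ys \<in> insert a (set ys)" unfolding ay by simp
    have "b \<in> {..<Suc (length ys)}" unfolding ay[symmetric] using assms(3) by simp
    moreover have "length ys \<le> b" using l assms(4) assms(5)[of "length ys"] by fastforce
    ultimately show ?thesis by simp
  qed
  \<comment> \<open>This will be the value of \<open>a\<close>. The subtraction is genuine, because
    \<open>ys\<close> contains \<open>b\<close>.\<close>
  define r where "r = length ys - 1"
  have len: "length ys = Suc r" using assms(3) by (cases ys) (auto simp: r_def)
  have a: "a = r"
  proof -
    have "r \<in> insert a (set ys)" unfolding ay by (simp add: len)
    moreover have "a < Suc r" using assms(4) b len by simp
    ultimately show ?thesis using assms(5)[of r] b by (auto simp: len)
  qed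
  have ys: "set ys = insert (Suc r) {..<r}"
  proof -
    have "set ys = insert a (set ys) - {a}" using assms(1) by auto
    also have "\<dots> = insert (Suc r) {..<r}" unfolding ay unfolding len a by auto
    finally show ?thesis .
  qed
  have "Suc r \<in> {..<n}" unfolding un[symmetric] ys by simp
  then show ?thesis
    unfolding swapped_splits_def using xs ys assms(1,7,8) a
    by (intro image_eqI[of _ _ "(r, xs, ys)"]) (auto simp: words_def len)
qed

lemma sum_list_eq_1_split:
  assumes "(\<Sum>x\<leftarrow>xs. f x) = (1::nat)"
  obtains us x vs where "xs = us @ x # vs" "f x = 1" "\<forall>u\<in>set us. f u = 0" "\<forall>v\<in>set vs. f v = 0"
proof -
  have "\<exists>us x vs. xs = us @ x # vs \<and> f x = 1 \<and> (\<forall>u\<in>set us. f u = 0) \<and> (\<forall>v\<in>set vs. f v = 0)"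
    using assms
  proof (induction xs)
    case (Cons y ys)
    show ?case
    proof (cases "f y = 0")
      case True
      then obtain us x vs where "ys = us @ x # vs" "f x = 1" "\<forall>u\<in>set us. f u = 0" "\<forall>v\<in>set vs. f v = 0"
        using Cons by auto
      then show ?thesis using True by (intro exI[of _ "y # us"] exI[of _ x] exI[of _ vs]) auto
    next
      case False
      moreover have "f y + (\<Sum>x\<leftarrow>ys. f x) = 1" using Cons.prems by simp
      ultimately have "f y = 1" "(\<Sum>x\<leftarrow>ys. f x) = 0" by linarith+
      then have "\<forall>v\<in>set ys. f v = 0" by simp
      with \<open>f y = 1\<close> show ?thesis
        by (intro exI[of _ "[]"] exI[of _ y] exI[of _ ys]) simp
    qed
  qed simp
  then show ?thesis using that by blast
qed

text \<open>Each pair \<open>x < y\<close> across the maximum costs an occurrence, so there is at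
  most one such pair. No pair gives a split, one pair a swapped split.\<close>

lemma words_cases:
  assumes "w \<in> words k {..<Suc n}" "k \<le> 1"
  shows "(\<exists>i j. i + j = k \<and> w \<in> splits i j n) \<or> k = 1 \<and> w \<in> swapped_splits n"
proof -
  have w: "distinct w" "set w = {..<Suc n}" "occ132_count w = k"
    using assms by (auto simp: words_def)
  then obtain xs ys where xy: "w = xs @ n # ys"
    by (metis lessI lessThan_iff split_list)
  have xn: "x < n" if "x \<in> set xs" for x
    using w(1,2) that unfolding xy by (auto simp: less_Suc_eq)
  have yn: "y < n" if "y \<in> set ys" for y
    using w(1,2) that unfolding xy by (auto simp: less_Suc_eq)
  define S where "S = (\<Sum>x\<leftarrow>xs. length (filter (\<lambda>y. x < y) ys))"
  have le: "occ132_count xs + occ132_count ys + S \<le> k"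
    using occ132_count_insert_max_ge[of xs n ys, OF xn yn] w(3) by (simp add: S_def xy)
  have disj: "x \<noteq> y" if "x \<in> set xs" "y \<in> set ys" for x y
    using w(1) that unfolding xy by auto
  consider "S = 0" | "S = 1" using le assms(2) by linarith
  then show ?thesis
  proof cases
    case 1
    have gt: "y < x" if "x \<in> set xs" "y \<in> set ys" for x y
      using 1 that disj[OF that] by (force simp: S_def filter_empty_conv)
    then have "k = occ132_count xs + occ132_count ys"
      using occ132_count_insert_max_gt[of xs n ys, OF xn yn gt] w(3) by (simp add: xy)
    then show ?thesis
      using splits_memI[OF w(1,2)[unfolded xy] gt] xy by blast
  next
    case 2
    \<comment> \<open>The crossing pair uses up the only occurrence, so both parts avoid
      132.\<close>
    then have k: "k = 1" "occ132_count xs = 0" "occ132_count ys = 0" using le assms(2) by auto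
    obtain us a vs where xs: "xs = us @ a # vs" and a: "length (filter (\<lambda>y. a < y) ys) = 1"
      and "\<forall>u\<in>set us. length (filter (\<lambda>y. u < y) ys) = 0"
      and "\<forall>v\<in>set vs. length (filter (\<lambda>y. v < y) ys) = 0"
      using sum_list_eq_1_split[OF 2[unfolded S_def]] by blast
    then have us: "y < u" if "u \<in> set us" "y \<in> set ys" for u y
      using that disj[of u y] by (force simp: filter_empty_conv xs)
    have vs: "y < v" if "v \<in> set vs" "y \<in> set ys" for v y
      using that disj[of v y] \<open>\<forall>v\<in>set vs. _\<close> by (force simp: filter_empty_conv xs)
    from a obtain b where b: "filter (\<lambda>y. a < y) ys = [b]"
      by (auto simp: length_Suc_conv)
    have sb: "{y \<in> set ys. a < y} = {b}"
      using b by (metis empty_set list.simps(15) set_filter)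
    then have by': "b \<in> set ys" "a < b" by blast+
    have oth: "y < a" if "y \<in> set ys" "y \<noteq> b" for y
    proof -
      have "\<not> a < y" using that sb by blast
      then show ?thesis using disj[of a y] that by (simp add: xs)
    qed
    \<comment> \<open>A letter \<open>c\<close> of \<open>vs\<close> would exceed \<open>b\<close>,
      and \<open>a c b\<close> would be a second occurrence besides \<open>a n b\<close>.\<close>
    have "vs = []"
    proof (rule ccontr)
      assume "vs \<noteq> []"
      then obtain c zs where c: "vs = c # zs" by (cases vs) auto
      have "b < c" using vs by' by (simp add: c)
      then have "0 < inversion_count (filter (\<lambda>z. a < z) (vs @ ys))"
        using by' by (auto simp: c filter_empty_conv)
      then have "1 < occ132_count (a # vs @ n # ys)"
        using occ132_count_Cons_insert_max[of a n vs ys] xn yn a by (simp add: xs)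
      also have "\<dots> \<le> occ132_count w"
        using occ132_count_le_append_right[of "a # vs @ n # ys" us] by (simp add: xy xs)
      finally show False using w(3) k by simp
    qed
    then have w': "w = us @ a # n # ys" by (simp add: xy xs)
    have "occ132_count us = 0"
      using occ132_count_le_append_left[of us "[a]"] k(2) by (simp add: xs \<open>vs = []\<close>)
    then show ?thesis
      using swapped_splits_memI[OF w(1,2)[unfolded w'] by' oth us _ k(3)] w' k by blast
  qed
qed

lemma words_0_eq: "words 0 {..<Suc n} = splits 0 0 n"
  using splits_subset_words[of 0 0 n] words_cases[of _ 0 n] by auto

lemma words_1_eq: "words 1 {..<Suc n} = splits 1 0 n \<union> splits 0 1 n \<union> swapped_splits n"
proof
  show "words 1 {..<Suc n} \<subseteq> splits 1 0 n \<union> splits 0 1 n \<union> swapped_splits n"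
    using words_cases[of _ 1 n] by (auto simp: add_is_1)
  show "splits 1 0 n \<union> splits 0 1 n \<union> swapped_splits n \<subseteq> words 1 {..<Suc n}"
    using splits_subset_words[of 1 0 n] splits_subset_words[of 0 1 n]
      swapped_splits_subset_words[of n] by simp
qed

section \<open>Recurrences for the inversion enumerators\<close>

lemma sum_Times:
  "(\<Sum>(x, y)\<in>A \<times> B. c * f x * g y) = c * sum f A * sum g B" for c :: "'a::comm_ring_1"
proof -
  have "(\<Sum>(x, y)\<in>A \<times> B. c * f x * g y) = (\<Sum>x\<in>A. \<Sum>y\<in>B. c * f x * g y)"
    by (rule sum.cartesian_product[symmetric])
  also have "\<dots> = (\<Sum>x\<in>A. c * f x * sum g B)"
    by (simp only: sum_distrib_left)
  also have "\<dots> = c * sum f A * sum g B"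
    by (subst sum_distrib_right[symmetric]) (simp only: sum_distrib_left)
  finally show ?thesis .
qed

text \<open>The exponent counts inversions between the pieces: each of the \<open>r\<close> letters
  after the maximum is smaller than the maximum and than all \<open>n - r\<close> letters before
  it.\<close>

lemma sum_splits:
  "(\<Sum>w\<in>splits i j n. q ^ inversion_count w) =
   (\<Sum>r\<le>n. q ^ (r * (n - r + 1)) * inv_poly q i {..<n - r} * inv_poly q j {..<r})"
proof -
  let ?A = "SIGMA r:{..n}. words i {r..<n} \<times> words j {..<r}"
  \<comment> \<open>The place of \<open>n\<close> determines both parts, and the length of the right
    part determines \<open>r\<close>.\<close>
  have inj: "inj_on (\<lambda>(r, xs, ys). xs @ n # ys) ?A"
  proof (rule inj_onI)
    fix t t' assume t: "t \<in> ?A" "t' \<in> ?A"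
      "(case t of (r, xs, ys) \<Rightarrow> xs @ n # ys) = (case t' of (r, xs, ys) \<Rightarrow> xs @ n # ys)"
    obtain r xs ys r' xs' ys' where [simp]: "t = (r, xs, ys)" "t' = (r', xs', ys')"
      by (metis prod_cases3)
    have "n \<notin> set xs" "n \<notin> set ys" using t(1) by (auto simp: words_def)
    moreover have "xs @ n # ys = xs' @ n # ys'" using t(3) by simp
    ultimately have "xs = xs' \<and> ys = ys'" by (metis append_Cons_eq_iff)
    moreover have "ys \<in> words j {..<r}" "ys' \<in> words j {..<r'}" using t by simp_all
    then have "length ys = r" "length ys' = r'" by (simp_all add: length_words)
    ultimately show "t = t'" by simp
  qed
  have e: "q ^ inversion_count (xs @ n # ys) = q ^ (r * (n - r + 1)) * q ^ inversion_count xs * q ^ inversion_count ys"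
    if "r \<le> n" "xs \<in> words i {r..<n}" "ys \<in> words j {..<r}" for r xs ys
  proof -
    have len: "length xs = n - r" "length ys = r"
      using that by (simp_all add: length_words)
    have "inversion_count (xs @ n # ys) = inversion_count (xs @ ys) + length ys"
      by (rule inversion_count_insert_max) (use that in \<open>auto simp: words_def\<close>)
    also have "inversion_count (xs @ ys) =
      inversion_count xs + inversion_count ys + length xs * length ys"
      by (rule inversion_count_append_gt) (use that in \<open>auto simp: words_def\<close>)
    finally have "inversion_count (xs @ n # ys) =
      inversion_count xs + inversion_count ys + r * (n - r + 1)"
      by (simp add: len)
    then show ?thesis by (simp add: power_add mult_ac)
  qed
  have "(\<Sum>w\<in>splits i j n. q ^ inversion_count w) =
    (\<Sum>(r, xs, ys)\<in>?A. q ^ inversion_count (xs @ n # ys))"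
    unfolding splits_def by (subst sum.reindex[OF inj]) (simp add: o_def case_prod_beta)
  also have "\<dots> = (\<Sum>r\<le>n. \<Sum>(xs, ys)\<in>words i {r..<n} \<times> words j {..<r}. q ^ inversion_count (xs @ n # ys))"
    by (subst sum.Sigma) auto
  also have "\<dots> = (\<Sum>r\<le>n. q ^ (r * (n - r + 1)) * inv_poly q i {r..<n} * inv_poly q j {..<r})"
  proof (rule sum.cong[OF refl])
    fix r assume "r \<in> {..n}"
    then have "(\<Sum>(xs, ys)\<in>words i {r..<n} \<times> words j {..<r}. q ^ inversion_count (xs @ n # ys)) =
      (\<Sum>(xs, ys)\<in>words i {r..<n} \<times> words j {..<r}. q ^ (r * (n - r + 1)) * q ^ inversion_count xs * q ^ inversion_count ys)"
      by (intro sum.cong) (auto simp: e)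
    also have "\<dots> = q ^ (r * (n - r + 1)) * inv_poly q i {r..<n} * inv_poly q j {..<r}"
      unfolding inv_poly_def by (rule sum_Times)
    finally show "(\<Sum>(xs, ys)\<in>words i {r..<n} \<times> words j {..<r}. q ^ inversion_count (xs @ n # ys)) =
      q ^ (r * (n - r + 1)) * inv_poly q i {r..<n} * inv_poly q j {..<r}" .
  qed
  also have "\<dots> = (\<Sum>r\<le>n. q ^ (r * (n - r + 1)) * inv_poly q i {..<n - r} * inv_poly q j {..<r})"
    using inv_poly_card[of "{r..<n}" q i for r] by simp
  finally show ?thesis .
qed

text \<open>In the exponent, the \<open>n - 2 - s\<close> letters of the left part exceed
  \<open>s\<close> and the \<open>s + 1\<close> letters after \<open>n\<close>; then
  \<open>s\<close> exceeds \<open>s\<close> of those letters, and \<open>n\<close> exceeds all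
  \<open>s + 1\<close>.\<close>

lemma sum_swapped_splits:
  "(\<Sum>w\<in>swapped_splits n. q ^ inversion_count w) =
   (\<Sum>s<n - 1. q ^ ((n - 2 - s) * (s + 2) + 2 * s + 1) * inv_poly q 0 {..<n - 2 - s} * inv_poly q 0 {..<Suc s})"
proof -
  let ?L = "\<lambda>s. words 0 {Suc (Suc s)..<n}" and ?R = "\<lambda>s. words 0 (insert (Suc s) {..<s})"
  let ?A = "SIGMA s:{..<n - 1}. ?L s \<times> ?R s"
  let ?e = "\<lambda>s. (n - 2 - s) * (s + 2) + 2 * s + 1"
  have inj: "inj_on (\<lambda>(s, xs, ys). xs @ s # n # ys) ?A"
  proof (rule inj_onI)
    fix t t' assume t: "t \<in> ?A" "t' \<in> ?A"
      "(case t of (s, xs, ys) \<Rightarrow> xs @ s # n # ys) = (case t' of (s, xs, ys) \<Rightarrow> xs @ s # n # ys)"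
    obtain s xs ys s' xs' ys' where [simp]: "t = (s, xs, ys)" "t' = (s', xs', ys')"
      by (metis prod_cases3)
    have "n \<notin> set (xs @ [s])" "n \<notin> set ys" using t(1) by (auto simp: words_def)
    moreover have "(xs @ [s]) @ n # ys = (xs' @ [s']) @ n # ys'" using t(3) by simp
    ultimately have "xs @ [s] = xs' @ [s'] \<and> ys = ys'" by (metis append_Cons_eq_iff)
    then show "t = t'" by simp
  qed
  have e: "q ^ inversion_count (xs @ s # n # ys) = q ^ ?e s * q ^ inversion_count xs * q ^ inversion_count ys"
    if "s < n - 1" "xs \<in> ?L s" "ys \<in> ?R s" for s xs ys
  proof -
    have len: "length xs = n - 2 - s" "length ys = Suc s"
      using that by (simp_all add: length_words)
    have "inversion_count (xs @ s # ys) =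
      inversion_count xs + inversion_count (s # ys) + length xs * length (s # ys)"
      by (rule inversion_count_append_gt) (use that in \<open>auto simp: words_def\<close>)
    moreover have "inversion_count (s # ys) = s + inversion_count ys"
    proof -
      have "filter (\<lambda>y. y < s) ys = filter (\<lambda>y. y \<noteq> Suc s) ys"
        by (rule filter_cong) (use that in \<open>auto simp: words_def\<close>)
      also have "length \<dots> = card (set ys - {Suc s})"
        using that by (simp add: words_def distinct_length_filter set_diff_eq Int_def conj_commute)
      also have "set ys - {Suc s} = {..<s}" using that by (auto simp: words_def)
      finally show ?thesis by simp
    qed
    moreover have "inversion_count ((xs @ [s]) @ n # ys) = inversion_count ((xs @ [s]) @ ys) + length ys"
      by (rule inversion_count_insert_max) (use that in \<open>auto simp: words_def\<close>)
    ultimately have "inversion_count (xs @ s # n # ys) = inversion_count xs + inversion_count ys + ?e s"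
      by (simp add: len algebra_simps)
    then show ?thesis by (simp add: power_add mult_ac)
  qed
  have "(\<Sum>w\<in>swapped_splits n. q ^ inversion_count w) =
    (\<Sum>(s, xs, ys)\<in>?A. q ^ inversion_count (xs @ s # n # ys))"
    unfolding swapped_splits_def by (subst sum.reindex[OF inj]) (simp add: o_def case_prod_beta)
  also have "\<dots> = (\<Sum>s<n - 1. \<Sum>(xs, ys)\<in>?L s \<times> ?R s. q ^ inversion_count (xs @ s # n # ys))"
    by (subst sum.Sigma) auto
  also have "\<dots> = (\<Sum>s<n - 1. q ^ ?e s * inv_poly q 0 {Suc (Suc s)..<n} * inv_poly q 0 (insert (Suc s) {..<s}))"
  proof (rule sum.cong[OF refl])
    fix s assume "s \<in> {..<n - 1}"
    then have "(\<Sum>(xs, ys)\<in>?L s \<times> ?R s. q ^ inversion_count (xs @ s # n # ys)) =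
      (\<Sum>(xs, ys)\<in>?L s \<times> ?R s. q ^ ?e s * q ^ inversion_count xs * q ^ inversion_count ys)"
      by (intro sum.cong) (auto simp: e)
    also have "\<dots> = q ^ ?e s * inv_poly q 0 {Suc (Suc s)..<n} * inv_poly q 0 (insert (Suc s) {..<s})"
      unfolding inv_poly_def by (rule sum_Times)
    finally show "(\<Sum>(xs, ys)\<in>?L s \<times> ?R s. q ^ inversion_count (xs @ s # n # ys)) =
      q ^ ?e s * inv_poly q 0 {Suc (Suc s)..<n} * inv_poly q 0 (insert (Suc s) {..<s})" .
  qed
  \<comment> \<open>The alphabet of the right part has a gap at \<open>s\<close>, but only its size
    \<open>Suc s\<close> matters.\<close>
  also have "\<dots> = (\<Sum>s<n - 1. q ^ ?e s * inv_poly q 0 {..<n - 2 - s} * inv_poly q 0 {..<Suc s})"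
    using inv_poly_card[of "{Suc (Suc s)..<n}" q 0 for s] inv_poly_card[of "insert (Suc s) {..<s}" q 0 for s]
    by simp
  finally show ?thesis .
qed

lemma inv_poly_0_Suc:
  "inv_poly q 0 {..<Suc n} =
   (\<Sum>r\<le>n. q ^ (r * (n - r + 1)) * inv_poly q 0 {..<n - r} * inv_poly q 0 {..<r})"
  unfolding inv_poly_def[of q 0 "{..<Suc n}"] words_0_eq sum_splits ..

text \<open>The three families are disjoint: the first two differ in the part that holds the
  occurrence, and only in the third does a letter before the maximum lie below one after it.\<close>

lemma inv_poly_1_Suc:
  "inv_poly q 1 {..<Suc n} =
   (\<Sum>r\<le>n. q ^ (r * (n - r + 1)) * inv_poly q 1 {..<n - r} * inv_poly q 0 {..<r}) +
   (\<Sum>r\<le>n. q ^ (r * (n - r + 1)) * inv_poly q 0 {..<n - r} * inv_poly q 1 {..<r}) +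
   (\<Sum>s<n - 1. q ^ ((n - 2 - s) * (s + 2) + 2 * s + 1) * inv_poly q 0 {..<n - 2 - s} * inv_poly q 0 {..<Suc s})"
proof -
  have fin: "finite (splits 1 0 n)" "finite (splits 0 1 n)" "finite (swapped_splits n)"
    using finite_words[of "{..<Suc n}" 1] unfolding words_1_eq by simp_all
  have d1: "splits 1 0 n \<inter> splits 0 1 n = {}"
    by (auto simp: splits_def words_def append_Cons_eq_iff)
  have ne: "xs @ s # n # ys \<noteq> us @ n # vs"
    if "xs \<in> words 0 {Suc (Suc s)..<n}" "s < n - 1" "ys \<in> words 0 (insert (Suc s) {..<s})"
      "us \<in> words i {r..<n}" "vs \<in> words j {..<r}" for s xs ys us vs i j r
  proof
    assume "xs @ s # n # ys = us @ n # vs"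
    then have "(xs @ [s]) @ n # ys = us @ n # vs" by simp
    moreover have "n \<notin> set (xs @ [s])" "n \<notin> set ys"
      using that(1-3) by (auto simp: words_def)
    ultimately have "xs @ [s] = us \<and> ys = vs"
      by (metis append_Cons_eq_iff)
    then have "s \<in> set us" "Suc s \<in> set vs" using that(3) by (auto simp: words_def)
    then show False using that(4,5) by (simp add: words_def)
  qed
  have d2: "splits i j n \<inter> swapped_splits n = {}" for i j
  proof (rule equals0I)
    fix w assume "w \<in> splits i j n \<inter> swapped_splits n"
    then obtain t t' where t: "t \<in> (SIGMA r:{..n}. words i {r..<n} \<times> words j {..<r})"
      "t' \<in> (SIGMA s:{..<n - 1}. words 0 {Suc (Suc s)..<n} \<times> words 0 (insert (Suc s) {..<s}))"
      "w = (case t of (r, us, vs) \<Rightarrow> us @ n # vs)" "w = (case t' of (s, xs, ys) \<Rightarrow> xs @ s # n # ys)"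
      unfolding splits_def swapped_splits_def by blast
    obtain r us vs s xs ys where tt: "t = (r, us, vs)" "t' = (s, xs, ys)"
      by (metis prod_cases3)
    then show False using t ne[of xs s ys us i r vs j] by simp
  qed
  have "inv_poly q 1 {..<Suc n} = (\<Sum>w\<in>splits 1 0 n. q ^ inversion_count w) +
     (\<Sum>w\<in>splits 0 1 n. q ^ inversion_count w) + (\<Sum>w\<in>swapped_splits n. q ^ inversion_count w)"
    unfolding inv_poly_def words_1_eq
    using fin d1 d2 by (simp add: sum.union_disjoint Int_Un_distrib2)
  then show ?thesis by (simp add: sum_splits sum_swapped_splits)
qed


section \<open>Functional equations at \<open>q = 1\<close> and \<open>q = -1\<close>\<close>

definition inv_fps :: "real \<Rightarrow> nat \<Rightarrow> real fps" where
  "inv_fps q k = Abs_fps (\<lambda>n. inv_poly q k {..<n})"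

lemma inv_poly_empty: "inv_poly q k {} = (if k = 0 then 1 else 0)"
proof -
  have "words k {} = (if k = 0 then {[]} else {})" by (auto simp: words_def)
  then show ?thesis by (simp add: inv_poly_def)
qed

lemma inv_fps_nth_0 [simp]: "inv_fps q 0 $ 0 = 1" "inv_fps q (Suc 0) $ 0 = 0"
  by (simp_all add: inv_fps_def inv_poly_empty)

lemma inv_fps_0_nth_Suc:
  "inv_fps q 0 $ Suc n = (\<Sum>r\<le>n. q ^ (r * (n - r + 1)) * inv_fps q 0 $ (n - r) * inv_fps q 0 $ r)"
  by (simp add: inv_fps_def inv_poly_0_Suc)

text \<open>The shift absorbs the index \<open>Suc s\<close>, so that the last sum is a convolution
  too.\<close>

lemma inv_fps_1_nth_Suc:
  "inv_fps q 1 $ Suc n =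
   (\<Sum>r\<le>n. q ^ (r * (n - r + 1)) * inv_fps q 1 $ (n - r) * inv_fps q 0 $ r) +
   (\<Sum>r\<le>n. q ^ (r * (n - r + 1)) * inv_fps q 0 $ (n - r) * inv_fps q 1 $ r) +
   (\<Sum>s<n - 1. q ^ ((n - 2 - s) * (s + 2) + 2 * s + 1) * inv_fps q 0 $ (n - 2 - s) * fps_shift 1 (inv_fps q 0) $ s)"
  using inv_poly_1_Suc[of q n] by (simp add: inv_fps_def)

lemma fps_nth_two_mult: "(2 * f) $ n = 2 * f $ n" for f :: "real fps"
  by (simp add: numeral_fps_const)

lemma fps_X_mult_shift: "fps_X * fps_shift 1 f = f - fps_const (f $ 0)"
  for f :: "'a::comm_ring_1 fps"
  by (rule fps_ext) (auto simp: fps_X_mult_nth gr0_conv_Suc)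

lemma sum_fps_mult: "(\<Sum>r\<le>n. f $ (n - r) * g $ r) = (f * g) $ n"
  for f g :: "'a::comm_ring_1 fps"
  unfolding mult.commute[of f] fps_mult_nth by (simp add: atMost_atLeast0 mult.commute)

abbreviation (input) neg_arg :: "real fps \<Rightarrow> real fps" where
  "neg_arg f \<equiv> f oo - fps_X"

lemma neg_arg_nth: "neg_arg f $ n = (-1) ^ n * f $ n"
  by (simp add: fps_compose_uminus')

text \<open>A sign depending on two parities is a linear combination of \<open>1\<close>,
  \<open>(-1)^r\<close>, \<open>(-1)^l\<close> and their product. In a convolution each such power
  becomes \<open>neg_arg\<close> on one factor.\<close>

lemma minus_one_power_mult_Suc:
  "2 * (-1 :: real) ^ (r * (l + 1)) = 1 + (-1) ^ r - (-1) ^ l + (-1) ^ l * (-1) ^ r"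
  by (cases "even l"; cases "even r") auto

lemma minus_one_power_mult:
  "2 * (-1 :: real) ^ (l * s) = 1 + (-1) ^ l + (-1) ^ s - (-1) ^ l * (-1) ^ s"
  by (cases "even l"; cases "even s") auto

lemma sum_fps_mult_signed_Suc:
  "2 * (\<Sum>r\<le>n. (-1) ^ (r * (n - r + 1)) * f $ (n - r) * g $ r) =
   (f * g + f * neg_arg g - neg_arg f * g + neg_arg f * neg_arg g) $ n"
  unfolding fps_add_nth fps_sub_nth sum_fps_mult[symmetric] sum.distrib[symmetric]
    sum_subtractf[symmetric] sum_distrib_left mult.assoc[symmetric] minus_one_power_mult_Suc neg_arg_nth
  by (simp add: algebra_simps)

lemma sum_fps_mult_signed:
  "2 * (\<Sum>r\<le>n. (-1) ^ ((n - r) * r) * f $ (n - r) * g $ r) =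
   (f * g + neg_arg f * g + f * neg_arg g - neg_arg f * neg_arg g) $ n"
  unfolding fps_add_nth fps_sub_nth sum_fps_mult[symmetric] sum.distrib[symmetric]
    sum_subtractf[symmetric] sum_distrib_left mult.assoc[symmetric] minus_one_power_mult neg_arg_nth
  by (simp add: algebra_simps)

text \<open>For swapped splits the cube accounts for the maximum, the letter \<open>s\<close> and
  the shift by one.\<close>

lemma fps_X_cube_mult_nth_Suc:
  "(fps_X ^ 3 * f) $ Suc n = (if n < 2 then 0 else f $ (n - 2))" for f :: "real fps"
  by (auto simp: fps_X_power_mult_nth Suc_diff_Suc numeral_2_eq_2)

lemma inv_fps_1_0: "inv_fps 1 0 = 1 + fps_X * inv_fps 1 0 ^ 2"
proof (rule fps_ext)
  show "inv_fps 1 0 $ n = (1 + fps_X * inv_fps 1 0 ^ 2) $ n" for n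
    by (cases n) (simp_all add: inv_fps_0_nth_Suc sum_fps_mult power2_eq_square)
qed

text \<open>For \<open>n < 2\<close> truncated subtraction leaves the range \<open>s < n - 1\<close>
  empty, but not the range \<open>s \<le> n - 2\<close>.\<close>

lemma sum_lessThan_pred:
  "(\<Sum>s<n - 1. f s) = (if n < 2 then 0 else \<Sum>s\<le>n - 2. f s)" for f :: "nat \<Rightarrow> real"
  by (auto intro!: sum.cong)

lemma inv_fps_1_1:
  "inv_fps 1 1 = 2 * fps_X * inv_fps 1 1 * inv_fps 1 0 + fps_X ^ 2 * inv_fps 1 0 * (inv_fps 1 0 - 1)"
proof -
  define C F D where "C = inv_fps 1 0" "F = inv_fps 1 1" "D = fps_shift 1 C"
  have "F = fps_X * (2 * F * C) + fps_X ^ 3 * (C * D)"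
  proof (rule fps_ext)
    show "F $ n = (fps_X * (2 * F * C) + fps_X ^ 3 * (C * D)) $ n" for n
    proof (cases n)
      case (Suc m)
      have "F $ Suc m = (F * C) $ m + (C * F) $ m + (if m < 2 then 0 else (C * D) $ (m - 2))"
        by (simp only: C_F_D_def inv_fps_1_nth_Suc sum_lessThan_pred power_one mult_1 sum_fps_mult)
      then show ?thesis
        by (simp add: Suc fps_X_cube_mult_nth_Suc mult.assoc fps_nth_two_mult mult.commute[of C F])
    qed (simp add: C_F_D_def)
  qed
  \<comment> \<open>So \<open>D\<close> stands for \<open>(C - 1) / x\<close>, and
    \<open>x^3 C D\<close> becomes \<open>x^2 C (C - 1)\<close>.\<close>
  moreover have "fps_X * D = C - 1"
    unfolding C_F_D_def by (subst fps_X_mult_shift) simp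
  ultimately have "F = 2 * fps_X * F * C + fps_X ^ 2 * C * (C - 1)"
    by algebra
  then show ?thesis by (simp only: C_F_D_def)
qed

lemma neg_arg_simps:
  "neg_arg (f + g) = neg_arg f + neg_arg g" "neg_arg (f - g) = neg_arg f - neg_arg g" "neg_arg (f * g) = neg_arg f * neg_arg g"
  "neg_arg (neg_arg f) = f" "neg_arg fps_X = - fps_X" "neg_arg 1 = 1" "neg_arg 2 = 2" "neg_arg (f ^ k) = neg_arg f ^ k"
proof -
  show "neg_arg (neg_arg f) = f"
    by (rule fps_ext) (simp add: neg_arg_nth flip: power_add mult.assoc)
  show "neg_arg (f * g) = neg_arg f * neg_arg g" by (rule fps_compose_mult_distrib) simp
  show "neg_arg (f ^ k) = neg_arg f ^ k" by (rule fps_compose_power[symmetric]) simp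
qed (simp_all add: fps_compose_add_distrib fps_compose_sub_distrib)

text \<open>In the signed convolution of \<open>C\<close> with itself the mixed products cancel. The
  factor 2 clears the halves.\<close>

lemma inv_fps_minus_1_0:
  "2 * inv_fps (-1) 0 = 2 + fps_X * (inv_fps (-1) 0 ^ 2 + neg_arg (inv_fps (-1) 0) ^ 2)"
proof (rule fps_ext)
  show "(2 * inv_fps (-1) 0) $ n = (2 + fps_X * (inv_fps (-1) 0 ^ 2 + neg_arg (inv_fps (-1) 0) ^ 2)) $ n" for n
  proof (cases n)
    case (Suc m)
    show ?thesis unfolding Suc fps_nth_two_mult inv_fps_0_nth_Suc sum_fps_mult_signed_Suc
      by (simp add: power2_eq_square algebra_simps fps_numeral_nth)
  qed (simp add: fps_nth_two_mult fps_numeral_nth)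
qed

text \<open>The mixed products of the convolutions \<open>F\<close> with \<open>C\<close> and
  \<open>C\<close> with \<open>F\<close> cancel each other; the swapped splits give the subtracted
  term.\<close>

lemma inv_fps_minus_1_1:
  fixes C F :: "real fps"
  defines "C \<equiv> inv_fps (-1) 0" and "F \<equiv> inv_fps (-1) 1"
  shows "2 * F = 2 * fps_X * (F * C + neg_arg F * neg_arg C)
    - fps_X ^ 2 * (C * (C - 1) + neg_arg C * (C - 1) - C * (neg_arg C - 1) + neg_arg C * (neg_arg C - 1))"
proof -
  define D where "D = fps_shift 1 C"
  have *: "2 * F = 2 * fps_X * (F * C + neg_arg F * neg_arg C)
    - fps_X ^ 3 * (C * D + neg_arg C * D + C * neg_arg D - neg_arg C * neg_arg D)"
    (is "_ = ?R")
  proof (rule fps_ext)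
    show "(2 * F) $ n = ?R $ n" for n
    proof (cases n)
      case (Suc m)
      \<comment> \<open>Modulo 2 the exponent is \<open>l * s + 1\<close>, hence the minus sign of
        this term.\<close>
      have e: "(-1 :: real) ^ (l * (s + 2) + 2 * s + 1) = - ((-1) ^ (l * s))" for l s
        by (cases "even l"; cases "even s") auto
      have "2 * F $ Suc m = (F * C + F * neg_arg C - neg_arg F * C + neg_arg F * neg_arg C) $ m
        + (C * F + C * neg_arg F - neg_arg C * F + neg_arg C * neg_arg F) $ m
        - (if m < 2 then 0 else (C * D + neg_arg C * D + C * neg_arg D - neg_arg C * neg_arg D) $ (m - 2))"
        unfolding sum_fps_mult_signed_Suc[symmetric] sum_fps_mult_signed[symmetric]
          C_def F_def D_def inv_fps_1_nth_Suc sum_lessThan_pred e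
        by (simp add: sum_negf distrib_left del: fps_shift_nth)
      also have "\<dots> = ?R $ Suc m"
      proof -
        have "(F * C + F * neg_arg C - neg_arg F * C + neg_arg F * neg_arg C) + (C * F + C * neg_arg F - neg_arg C * F + neg_arg C * neg_arg F)
          = 2 * (F * C + neg_arg F * neg_arg C)" by (simp add: algebra_simps)
        from arg_cong[OF this, of "\<lambda>f. f $ m"] show ?thesis
          by (simp only: fps_sub_nth fps_X_cube_mult_nth_Suc mult.assoc mult.left_commute[of _ fps_X]
             fps_add_nth[symmetric]) simp
      qed
      finally show ?thesis by (simp add: Suc fps_nth_two_mult)
    qed (simp add: F_def fps_nth_two_mult)
  qed
  have D: "fps_X * D = C - 1"
    unfolding D_def C_def by (subst fps_X_mult_shift) simp
  \<comment> \<open>The substitution also negates the factor \<open>x\<close>, which flips the two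
    terms with \<open>neg_arg D\<close>.\<close>
  have "neg_arg (fps_X * D) = neg_arg C - 1" unfolding D neg_arg_simps ..
  then have "- fps_X * neg_arg D = neg_arg C - 1" unfolding neg_arg_simps .
  with D * show ?thesis by algebra
qed

section \<open>Closed forms by inverse square roots\<close>

lemma inv_sqrt_one_plus_nth_0: "inv_sqrt_one_plus u $ 0 = 1"
  by (simp add: inv_sqrt_one_plus_def)

text \<open>The product squares to 1, so it is 1 or -1 in the domain of power series, and the
  constant term decides.\<close>

lemma inv_sqrt_one_plus_unique:
  assumes "u $ 0 = 0" "s ^ 2 = 1 + u" "s $ 0 = 1"
  shows "inv_sqrt_one_plus u * s = 1"
proof -
  have "(inv_sqrt_one_plus u * s) ^ 2 = 1"
    using inv_sqrt_one_plus_square[OF assms(1)] assms(2) by (simp add: power_mult_distrib)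
  then consider "inv_sqrt_one_plus u * s = 1" | "inv_sqrt_one_plus u * s = -1"
    by (auto simp: power2_eq_1_iff)
  then show ?thesis
  proof cases
    case 2
    then have "(inv_sqrt_one_plus u * s) $ 0 = - 1" by simp
    then show ?thesis by (simp add: inv_sqrt_one_plus_nth_0 assms(3))
  qed
qed

lemma inv_fps_1_1_closed:
  "2 * inv_fps 1 1 = fps_X - 1 + (1 - 3 * fps_X) * inv_sqrt_one_plus (- 4 * fps_X)"
proof -
  define C F T where "C = inv_fps 1 0" "F = inv_fps 1 1" "T = inv_sqrt_one_plus (- 4 * fps_X)"
  have C: "C = 1 + fps_X * C ^ 2" and F: "F = 2 * fps_X * F * C + fps_X ^ 2 * C * (C - 1)"
    using inv_fps_1_0 inv_fps_1_1 unfolding C_F_T_def by auto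
  \<comment> \<open>This is the quadratic equation for \<open>C\<close> with the square
    completed.\<close>
  have "T * (1 - 2 * fps_X * C) = 1"
    unfolding C_F_T_def(3)
  proof (rule inv_sqrt_one_plus_unique)
    show "(1 - 2 * fps_X * C) ^ 2 = 1 + - 4 * fps_X" using C by algebra
  qed (simp_all add: fps_mult_nth_0)
  \<comment> \<open>The equation for \<open>F\<close> reads
    \<open>F (1 - 2 x C) = x^2 C (C - 1)\<close>. Multiply by \<open>T\<close> and reduce with
    \<open>x C^2 = C - 1\<close>.\<close>
  with C F have "2 * F = fps_X - 1 + (1 - 3 * fps_X) * T" by algebra
  then show ?thesis by (simp only: C_F_T_def)
qed

lemma inv_fps_minus_1_1_closed:
  "2 * inv_fps (-1) 1 = - (1 - 3 * fps_X - 2 * fps_X ^ 2)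
     + (1 - 3 * fps_X - 4 * fps_X ^ 2 + 4 * fps_X ^ 3) * inv_sqrt_one_plus (- 4 * fps_X ^ 2)"
proof -
  define C F T where "C = inv_fps (-1) 0" "F = inv_fps (-1) 1" "T = inv_sqrt_one_plus (- 4 * fps_X ^ 2)"
  define G where "G = neg_arg F"
  define Q where "Q = C - 1"
  have C: "2 * C = 2 + fps_X * (C ^ 2 + neg_arg C ^ 2)"
    using inv_fps_minus_1_0 by (simp only: C_F_T_def)
  \<comment> \<open>Adding the equation to its image under negation of \<open>x\<close> cancels the
    squares, so \<open>C - 1\<close> is odd.\<close>
  have "neg_arg (2 * C) = neg_arg (2 + fps_X * (C ^ 2 + neg_arg C ^ 2))"
    using C by simp
  then have "2 * neg_arg C = 2 - fps_X * (neg_arg C ^ 2 + C ^ 2)"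
    unfolding neg_arg_simps by simp
  with C have "2 * (C + neg_arg C) = 2 * 2" by algebra
  then have "C + neg_arg C = 2" by (subst (asm) mult_cancel_left) simp
  then have Cb: "neg_arg C = 1 - Q" unfolding Q_def by (simp add: algebra_simps)
  have C': "C = 1 + Q" by (simp add: Q_def)
  have "2 * (1 + Q) = 2 + fps_X * ((1 + Q) ^ 2 + (1 - Q) ^ 2)"
    using C unfolding Cb unfolding C' .
  then have "2 * Q = 2 * (fps_X * (1 + Q ^ 2))" by algebra
  then have Q: "Q = fps_X * (1 + Q ^ 2)" by simp
  have "2 * F = 2 * fps_X * (F * (1 + Q) + G * (1 - Q)) - fps_X ^ 2 *
      ((1 + Q) * Q + (1 - Q) * Q - (1 + Q) * (- Q) + (1 - Q) * (- Q))"
    using inv_fps_minus_1_1 unfolding C_F_T_def[symmetric] G_def[symmetric] Cb unfolding C' by simp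
  then have "2 * F = 2 * (fps_X * (F * (1 + Q) + G * (1 - Q)) - fps_X ^ 2 * (Q + Q ^ 2))"
    by algebra
  then have F: "F = fps_X * (F * (1 + Q) + G * (1 - Q)) - fps_X ^ 2 * (Q + Q ^ 2)"
    by (subst (asm) mult_cancel_left) simp
  have "neg_arg Q = - Q" unfolding Q_def neg_arg_simps Cb by (simp add: Q_def)
  moreover have "neg_arg F = neg_arg (fps_X * (F * (1 + Q) + G * (1 - Q)) - fps_X ^ 2 * (Q + Q ^ 2))"
    using F by simp
  ultimately have G: "G = - fps_X * (G * (1 - Q) + F * (1 + Q)) - fps_X ^ 2 * (- Q + Q ^ 2)"
    unfolding G_def neg_arg_simps by simp
  have s: "T * (1 - 2 * fps_X * Q) = 1"
    unfolding C_F_T_def(3)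
  proof (rule inv_sqrt_one_plus_unique)
    show "(1 - 2 * fps_X * Q) ^ 2 = 1 + - 4 * fps_X ^ 2" using Q by algebra
  qed (simp_all add: fps_mult_nth_0)
  \<comment> \<open>Sum and difference decouple the equations for \<open>F\<close> and
    \<open>G\<close>: the brackets cancel in \<open>F + G\<close>, and \<open>F - G\<close> acquires
    the factor \<open>1 - 2 x Q\<close>.\<close>
  have "(F - G) * (1 - 2 * fps_X * Q) = - 4 * fps_X ^ 3 * Q ^ 2 - 2 * fps_X ^ 2 * Q"
    using F G by algebra
  moreover have "F + G = - 2 * fps_X ^ 2 * Q ^ 2" using F G by algebra
  \<comment> \<open>Here \<open>2 F = (F + G) + (F - G)\<close>, with \<open>T\<close> dividing by
    \<open>1 - 2 x Q\<close> and \<open>x Q^2 = Q - x\<close> removing the squares.\<close>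
  ultimately have "2 * F = - (1 - 3 * fps_X - 2 * fps_X ^ 2)
     + (1 - 3 * fps_X - 4 * fps_X ^ 2 + 4 * fps_X ^ 3) * T"
    using s Q by algebra
  then show ?thesis by (simp only: C_F_T_def)
qed

section \<open>Even and odd permutations from the sum and the difference\<close>

lemma sum_power_inversions:
  "(\<Sum>p\<in>one132 n. (-1 :: real) ^ card (inversions n p)) = E1 $ n - O1 $ n"
proof -
  have "(\<Sum>p\<in>one132 n. (-1 :: real) ^ card (inversions n p)) =
    (\<Sum>p\<in>{p \<in> one132 n. even (card (inversions n p))} \<union> {p \<in> one132 n. odd (card (inversions n p))}.
      (-1) ^ card (inversions n p))"
    by (rule sum.cong) auto
  also have "\<dots> = E1 $ n - O1 $ n"
    by (subst sum.union_disjoint) (auto simp: E1_def O1_def finite_one132)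
  finally show ?thesis .
qed

lemma E1_plus_O1: "E1 + O1 = inv_fps 1 1"
proof (rule fps_ext)
  show "(E1 + O1) $ n = inv_fps 1 1 $ n" for n
    using F1_nth[of n] inv_poly_one132[of "1 :: real" n] by (simp add: F1_def inv_fps_def)
qed

lemma E1_minus_O1: "E1 - O1 = inv_fps (-1) 1"
proof (rule fps_ext)
  show "(E1 - O1) $ n = inv_fps (-1) 1 $ n" for n
    using sum_power_inversions[of n] inv_poly_one132[of "- 1 :: real" n] by (simp add: inv_fps_def)
qed

theorem theorem5:
  shows "E1 = - fps_const (1/2) * (1 - 2 * fps_X - fps_X ^ 2)
           + fps_const (1/4) * (1 - 3 * fps_X) * inv_sqrt_one_plus (- 4 * fps_X)
           + fps_const (1/4) * (1 - 3 * fps_X - 4 * fps_X ^ 2 + 4 * fps_X ^ 3)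
               * inv_sqrt_one_plus (- 4 * fps_X ^ 2) \<and>
         O1 = - fps_const (1/2) * (fps_X + fps_X ^ 2)
           + fps_const (1/4) * (1 - 3 * fps_X) * inv_sqrt_one_plus (- 4 * fps_X)
           - fps_const (1/4) * (1 - 3 * fps_X - 4 * fps_X ^ 2 + 4 * fps_X ^ 3)
               * inv_sqrt_one_plus (- 4 * fps_X ^ 2) \<and>
         F1 = fps_const (1/2) * (fps_X - 1)
           + fps_const (1/2) * (1 - 3 * fps_X) * inv_sqrt_one_plus (- 4 * fps_X)"
proof -
  \<comment> \<open>The fractions enter only through \<open>2 * h = 1\<close> and
    \<open>2 * k = h\<close>, which turns the claim into ring identities.\<close>
  define h k :: "real fps" where "h = fps_const (1/2)" and "k = fps_const (1/4)"
  have hk: "2 * h = 1" "2 * k = h"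
    by (simp_all add: h_def k_def numeral_fps_const)
  define T U where "T = inv_sqrt_one_plus (- 4 * fps_X)" and "U = inv_sqrt_one_plus (- 4 * fps_X ^ 2)"
  have 1: "2 * (E1 + O1) = fps_X - 1 + (1 - 3 * fps_X) * T"
    unfolding E1_plus_O1 T_def by (rule inv_fps_1_1_closed)
  have 2: "2 * (E1 - O1) = - (1 - 3 * fps_X - 2 * fps_X ^ 2)
     + (1 - 3 * fps_X - 4 * fps_X ^ 2 + 4 * fps_X ^ 3) * U"
    unfolding E1_minus_O1 U_def by (rule inv_fps_minus_1_1_closed)
  show ?thesis
    unfolding h_def[symmetric] k_def[symmetric] T_def[symmetric] U_def[symmetric] F1_def
    using 1 2 hk by (intro conjI) algebra+
qed

end
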